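(* For any Banach space $X$ and $1\le p\le\infty$, $$\overline{\mathrm{B}(I_{w^*}[X])}^{\|\cdot\|_\infty}=\overline{\mathrm{B}(\overline{I}_{w^*}^{p}[X])}^{\|\cdot\|_\infty}=\mathrm{B}(H_{w^*}^{p}[X]),$$ where $\mathrm{B}(H_{w^*}^{p}[X])=\{f\in H_{w^*}^{p}[X]:\|f\|_p\le1\}$, $\mathrm{B}(\overline{I}_{w^*}^{p}[X])=\{f\in \overline{I}_{w^*}^{p}[X]:\|f\|_p\le1\}$, and $\mathrm{B}(I_{w^*}[X])=\{f\in I_{w^*}[X]:\|f\|_p\le1\}$.
   Context: All Banach spaces are real. Let $1/p+1/p'=1$. For $z_1,\dots,z_n$ in a Banach space, $\|(z_i)_{i=1}^n\|_{p,\mathrm{weak}}=\sup\{\|\sum_i\alpha_i z_i\| : \|(\alpha_i)_i\|_{\ell_{p'}}\le 1\}$. For a Banach space $X$, $H_{w^*}[X]$ is the vector lattice (pointwise operations and order) of positively homogeneous functions $f:X^*\to\mathbb R$ that are weak$^*$-continuous on bounded sets. For $f\in H_{w^*}[X]$, $\|f\|_p$ is the infimum of all $C\ge 0$ such that $(\sum_{i=1}^n|f(x_i^* )|^p)^{1/p}\le C\|(x_i^* )_{i=1}^n\|_{p,\mathrm{weak}}$ for all $n$ and all $x_1^*,\dots,x_n^*\in X^*$ (for $p=\infty$ this equals the sup norm over the unit ball of $X^*$). $H_{w^*}^p[X]=\{f\in H_{w^*}[X]:\|f\|_p<\infty\}$, normed by $\|\cdot\|_p$. For $x\in X$, $\delta_x(x^*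 )=\langle x^*,x\rangle$. $I_{w^*}[X]$ is the (order) ideal of $H_{w^*}[X]$ generated by $\{\delta_x:x\in X\}$; $\overline{I}_{w^*}^p[X]$ is the closure of $I_{w^*}[X]$ in $H_{w^*}^p[X]$. Let $K$ be the closed unit ball of $X^*$ with the weak$^*$ topology. All these function spaces are regarded (by restriction to $K$) as linear subspaces of $C(K)$; $\overline{\,\cdot\,}^{\|\cdot\|_\infty}$ denotes closure in $C(K)$ with respect to the sup norm $\|\cdot\|_\infty$. *)

theory Defs
  imports "HOL-Analysis.Analysis"
begin

text \<open>The dual space of \<open>'a\<close> is the type \<open>'a \<Rightarrow>\<^sub>L real\<close> of bounded linear functionals. For the
  scalar codomain the strong operator topology is the topology of pointwise convergence,
  that is, the weak-star topology.\<close>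

definition weak_star_topology :: "('a::real_normed_vector \<Rightarrow>\<^sub>L real) topology" where
  "weak_star_topology = strong_operator_topology"

text \<open>Exponents range over the extended reals \<open>1 \<le> p \<le> \<infinity>\<close>.\<close>

definition conj_exponent :: "ereal \<Rightarrow> ereal" where
  "conj_exponent p =
     (if p = 1 then \<infinity> else if p = \<infinity> then 1
      else ereal (real_of_ereal p / (real_of_ereal p - 1)))"

text \<open>A finite family \<open>a\<^sub>1, \<dots>, a\<^sub>n\<close> is given by the values of a function on \<open>{..<n}\<close>. In the case
  \<open>p = \<infinity>\<close>, inserting 0 only matters for the empty family.\<close>

definition lp_norm :: "ereal \<Rightarrow> nat \<Rightarrow> (nat \<Rightarrow> real) \<Rightarrow> real" where
  "lp_norm p n a =
     (if p = \<infinity> then Max (insert 0 ((\<lambda>i. \<bar>a i\<bar>) ` {..<n}))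
      else (\<Sum>i<n. \<bar>a i\<bar> powr real_of_ereal p) powr (1 / real_of_ereal p))"

text \<open>The supremum is over a nonempty set bounded by \<open>\<Sum>i<n. norm (z i)\<close>, so the real-valued
  \<open>SUP\<close> is meaningful.\<close>

definition weak_norm :: "ereal \<Rightarrow> nat \<Rightarrow> (nat \<Rightarrow> 'b::real_normed_vector) \<Rightarrow> real" where
  "weak_norm p n z =
     (SUP \<alpha>\<in>{\<alpha>. lp_norm (conj_exponent p) n \<alpha> \<le> 1}. norm (\<Sum>i<n. \<alpha> i *\<^sub>R z i))"

definition positively_homogeneous :: "('b::real_vector \<Rightarrow> real) \<Rightarrow> bool" where
  "positively_homogeneous f \<longleftrightarrow> (\<forall>t\<ge>0. \<forall>x. f (t *\<^sub>R x) = t * f x)"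

definition H_w :: "(('a::banach \<Rightarrow>\<^sub>L real) \<Rightarrow> real) set" where
  "H_w = {f. positively_homogeneous f \<and>
             (\<forall>S. bounded S \<longrightarrow>
                continuous_map (subtopology weak_star_topology S) euclideanreal f)}"

text \<open>The value is \<open>\<infinity>\<close> when no admissible constant exists.\<close>

definition pnorm :: "ereal \<Rightarrow> (('a::banach \<Rightarrow>\<^sub>L real) \<Rightarrow> real) \<Rightarrow> ereal" where
  "pnorm p f =
     Inf {ereal C | C. 0 \<le> C \<and>
        (\<forall>n (x :: nat \<Rightarrow> ('a \<Rightarrow>\<^sub>L real)). lp_norm p n (\<lambda>i. f (x i)) \<le> C * weak_norm p n x)}"

definition Hp_w :: "ereal \<Rightarrow> (('a::banach \<Rightarrow>\<^sub>L real) \<Rightarrow> real) set" where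
  "Hp_w p = {f \<in> H_w. pnorm p f < \<infinity>}"

definition point_eval :: "'a::banach \<Rightarrow> ('a \<Rightarrow>\<^sub>L real) \<Rightarrow> real" where
  "point_eval x = (\<lambda>\<phi>. blinfun_apply \<phi> x)"

text \<open>Order ideals of the vector lattice \<open>H_w\<close>: solid linear subspaces.\<close>

definition order_ideal_H_w :: "(('a::banach \<Rightarrow>\<^sub>L real) \<Rightarrow> real) set \<Rightarrow> bool" where
  "order_ideal_H_w J \<longleftrightarrow>
     J \<subseteq> H_w \<and> (\<lambda>_. 0) \<in> J \<and>
     (\<forall>f\<in>J. \<forall>g\<in>J. (\<lambda>\<phi>. f \<phi> + g \<phi>) \<in> J) \<and>
     (\<forall>c. \<forall>f\<in>J. (\<lambda>\<phi>. c * f \<phi>) \<in> J) \<and>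
     (\<forall>f\<in>H_w. \<forall>g\<in>J. (\<forall>\<phi>. \<bar>f \<phi>\<bar> \<le> \<bar>g \<phi>\<bar>) \<longrightarrow> f \<in> J)"

definition I_w :: "(('a::banach \<Rightarrow>\<^sub>L real) \<Rightarrow> real) set" where
  "I_w = \<Inter>{J. order_ideal_H_w J \<and> range point_eval \<subseteq> J}"

text \<open>The closure of \<open>I_w\<close> in the normed space \<open>(Hp_w p, pnorm p)\<close>.\<close>

definition Ip_closure_w :: "ereal \<Rightarrow> (('a::banach \<Rightarrow>\<^sub>L real) \<Rightarrow> real) set" where
  "Ip_closure_w p =
     {f \<in> Hp_w p. \<forall>\<epsilon>>0. \<exists>g\<in>I_w. pnorm p (\<lambda>\<phi>. f \<phi> - g \<phi>) < ereal \<epsilon>}"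

definition p_unit_ball ::
  "ereal \<Rightarrow> (('a::banach \<Rightarrow>\<^sub>L real) \<Rightarrow> real) set \<Rightarrow> (('a \<Rightarrow>\<^sub>L real) \<Rightarrow> real) set" where
  "p_unit_ball p A = {f \<in> A. pnorm p f \<le> 1}"

definition dual_ball_topology :: "('a::banach \<Rightarrow>\<^sub>L real) topology" where
  "dual_ball_topology = subtopology weak_star_topology (cball 0 1)"

text \<open>\<open>C(K)\<close> with the sup metric; its elements are functions that are \<open>undefined\<close> outside \<open>K\<close>,
  hence the use of \<open>restrict\<close> for restriction to \<open>K\<close>.\<close>

definition CK :: "(('a::banach \<Rightarrow>\<^sub>L real) \<Rightarrow> real) metric" where
  "CK = cfunspace dual_ball_topology euclidean_metric"

definition restrict_K ::
  "(('a::banach \<Rightarrow>\<^sub>L real) \<Rightarrow> real) set \<Rightarrow> (('a \<Rightarrow>\<^sub>L real) \<Rightarrow> real) set" where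
  "restrict_K A = (\<lambda>f. restrict f (cball 0 1)) ` A"

definition sup_closure ::
  "(('a::banach \<Rightarrow>\<^sub>L real) \<Rightarrow> real) set \<Rightarrow> (('a \<Rightarrow>\<^sub>L real) \<Rightarrow> real) set" where
  "sup_closure A = mtopology_of CK closure_of (restrict_K A)"

end

theory Submission
  imports Defs
begin

text \<open>Truncation gives the density of \<open>B(I)\<close> in \<open>B(H\<^sup>p)\<close>. Let \<open>f\<close> have \<open>p\<close>-norm at most 1, so that
  \<open>\<bar>f\<bar> \<le> 1\<close> on the dual ball. By weak-star continuity at 0 there are finitely many \<open>x\<^sub>i\<close> and a
  \<open>\<eta> > 0\<close> such that \<open>\<bar>f \<phi>\<bar> < \<epsilon>\<close> whenever \<open>\<phi>\<close> in the ball satisfies \<open>\<bar>\<phi> x\<^sub>i\<bar> < \<eta>\<close> for all \<open>i\<close>. Put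
  \<open>h = (1/\<eta>) \<Sum>\<^sub>i \<bar>\<delta>\<^bsub>x\<^sub>i\<^esub>\<bar>\<close>. Truncating \<open>f\<close> to the order interval \<open>[-h, h]\<close> yields an element \<open>g\<close> of the
  ideal with \<open>\<bar>g\<bar> \<le> \<bar>f\<bar>\<close>, whence its \<open>p\<close>-norm is at most 1, and \<open>g\<close> differs from \<open>f\<close> only where
  \<open>h < \<bar>f\<bar> \<le> 1\<close>, hence only where \<open>\<bar>f\<bar> < \<epsilon>\<close>.

  Closedness of \<open>B(H\<^sup>p)\<close> holds because the condition \<open>\<parallel>f\<parallel>\<^sub>p \<le> 1\<close> is pointwise, and a uniform
  limit on the ball extends to a homogeneous function that is a uniform limit on every bounded set.\<close>

section \<open>Finite \<open>p\<close>-norms\<close>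

lemma ereal_ge_1_cases:
  fixes p :: ereal
  assumes "1 \<le> p"
  obtains "p = \<infinity>" | r where "p = ereal r" "1 \<le> r"
  using assms by (cases p) auto

lemma lp_norm_mono:
  assumes "1 \<le> p" and "\<And>i. i < n \<Longrightarrow> \<bar>a i\<bar> \<le> \<bar>b i\<bar>"
  shows "lp_norm p n a \<le> lp_norm p n b"
  using assms(1)
proof (cases p rule: ereal_ge_1_cases)
  case 1
  have "\<bar>a i\<bar> \<le> Max (insert 0 ((\<lambda>i. \<bar>b i\<bar>) ` {..<n}))" if "i < n" for i
    by (rule order.trans[OF assms(2)[OF that]]) (use that in simp)
  then show ?thesis
    using 1 by (auto simp: lp_norm_def intro: Max_ge)
next
  case (2 r)
  then show ?thesis
    by (auto simp: lp_norm_def intro!: powr_mono2 sum_mono sum_nonneg assms)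
qed

lemma abs_le_lp_norm:
  assumes "1 \<le> p" "i < n"
  shows "\<bar>a i\<bar> \<le> lp_norm p n a"
  using assms(1)
proof (cases p rule: ereal_ge_1_cases)
  case 1
  then show ?thesis
    using assms(2) by (auto simp: lp_norm_def intro: Max_ge)
next
  case (2 r)
  have "\<bar>a i\<bar> powr r \<le> (\<Sum>i<n. \<bar>a i\<bar> powr r)"
    using assms(2) by (intro member_le_sum) auto
  then have "(\<bar>a i\<bar> powr r) powr (1/r) \<le> (\<Sum>i<n. \<bar>a i\<bar> powr r) powr (1/r)"
    using 2 by (intro powr_mono2) auto
  then show ?thesis
    using 2 by (simp add: lp_norm_def powr_powr)
qed

lemma lp_norm_zero [simp]: "lp_norm p n (\<lambda>_. 0) = 0"
proof -
  have "Max (insert 0 ((\<lambda>_. 0) ` {..<n})) = (0::real)"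
    by (rule Max_eqI) auto
  then show ?thesis
    by (simp add: lp_norm_def)
qed

lemma lp_norm_one:
  assumes "1 \<le> p"
  shows "lp_norm p (Suc 0) a = \<bar>a 0\<bar>"
  using assms by (cases p rule: ereal_ge_1_cases) (auto simp: lp_norm_def powr_powr lessThan_Suc)

lemma tendsto_lp_norm:
  assumes "1 \<le> p" and lim: "\<And>i. i < n \<Longrightarrow> ((\<lambda>k. a k i) \<longlongrightarrow> b i) F"
  shows "((\<lambda>k. lp_norm p n (a k)) \<longlongrightarrow> lp_norm p n b) F"
  using assms(1)
proof (cases p rule: ereal_ge_1_cases)
  case 1
  \<comment> \<open>Splitting off one entry at a time reduces the limit of a finite
    \<open>Max\<close> to continuity of the binary \<open>max\<close>; the inserted 0 is the value
    at \<open>n = 0\<close>.\<close>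
  have lp_norm_Suc: "lp_norm \<infinity> (Suc n) c = max \<bar>c n\<bar> (lp_norm \<infinity> n c)" for n c
    by (simp add: lp_norm_def lessThan_Suc insert_commute[of 0])
  from lim have "((\<lambda>k. lp_norm \<infinity> n (a k)) \<longlongrightarrow> lp_norm \<infinity> n b) F"
  proof (induction n)
    case 0
    then show ?case by (simp add: lp_norm_def)
  next
    case (Suc n)
    then show ?case
      unfolding lp_norm_Suc
      by (intro tendsto_max tendsto_rabs) auto
  qed
  with 1 show ?thesis by simp
next
  case (2 r)
  \<comment> \<open>The limiting sum may be 0. There \<open>powr\<close> is handled by
    \<open>tendsto_powr'\<close>, which asks for a positive exponent and a nonnegative base.\<close>
  show ?thesis
    using 2 lim by (auto simp: lp_norm_def intro!: tendsto_powr' tendsto_sum tendsto_rabs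
        always_eventually sum_nonneg)
qed

lemma conj_exponent_ge_1:
  assumes "1 \<le> p"
  shows "1 \<le> conj_exponent p"
  using assms
  by (cases p rule: ereal_ge_1_cases) (auto simp: conj_exponent_def one_ereal_def divide_simps)

section \<open>The weak \<open>p\<close>-norm and \<open>\<parallel>\<cdot>\<parallel>\<^sub>p\<close>\<close>

text \<open>The zero coefficients contribute the value 0. For this to bound the real
  \<open>SUP\<close> from below, the set must be bounded above, which holds since admissible
  coefficients have modulus at most 1.\<close>

lemma weak_norm_nonneg:
  assumes "1 \<le> p"
  shows "0 \<le> weak_norm p n z"
proof -
  let ?A = "{\<alpha>. lp_norm (conj_exponent p) n \<alpha> \<le> 1}"
  have "norm (\<Sum>i<n. \<alpha> i *\<^sub>R z i) \<le> (\<Sum>i<n. norm (z i))" if "\<alpha> \<in> ?A" for \<alpha>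
  proof (rule sum_norm_le)
    fix i assume "i \<in> {..<n}"
    then have "\<bar>\<alpha> i\<bar> \<le> 1"
      using abs_le_lp_norm[OF conj_exponent_ge_1[OF assms], of i n \<alpha>] that by auto
    then show "norm (\<alpha> i *\<^sub>R z i) \<le> norm (z i)"
      by (simp add: mult_left_le_one_le)
  qed
  then have "bdd_above ((\<lambda>\<alpha>. norm (\<Sum>i<n. \<alpha> i *\<^sub>R z i)) ` ?A)"
    by (rule bdd_aboveI2)
  moreover have "(\<lambda>_. 0) \<in> ?A"
    by simp
  ultimately show ?thesis
    unfolding weak_norm_def by (intro cSUP_upper2[where x = "\<lambda>_. 0"]) auto
qed

lemma weak_norm_one_le:
  assumes "1 \<le> p"
  shows "weak_norm p (Suc 0) z \<le> norm (z 0)"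
  unfolding weak_norm_def
proof (rule cSUP_least)
  show "{\<alpha>. lp_norm (conj_exponent p) (Suc 0) \<alpha> \<le> 1} \<noteq> {}"
    by (auto intro!: exI[of _ "\<lambda>_. 0"])
next
  fix \<alpha> assume "\<alpha> \<in> {\<alpha>. lp_norm (conj_exponent p) (Suc 0) \<alpha> \<le> 1}"
  then show "norm (\<Sum>i<Suc 0. \<alpha> i *\<^sub>R z i) \<le> norm (z 0)"
    by (simp add: lp_norm_one conj_exponent_ge_1[OF assms] mult_left_le_one_le)
qed

text \<open>The infimum defining \<open>pnorm\<close> is attained, since the inequalities are closed
  in the constant \<open>C\<close>. In this form the unit ball is cut out by conditions on finitely
  many values of \<open>f\<close> at a time, which suits both domination and pointwise
  limits.\<close>

lemma pnorm_le_one_iff: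
  fixes f :: "('a::banach \<Rightarrow>\<^sub>L real) \<Rightarrow> real"
  assumes "1 \<le> p"
  shows "pnorm p f \<le> 1 \<longleftrightarrow> (\<forall>n x. lp_norm p n (\<lambda>i. f (x i)) \<le> weak_norm p n x)"
    (is "_ \<longleftrightarrow> ?R")
proof
  assume le: "pnorm p f \<le> 1"
  show ?R
  proof (intro allI)
    fix n and x :: "nat \<Rightarrow> ('a \<Rightarrow>\<^sub>L real)"
    let ?W = "weak_norm p n x"
    \<comment> \<open>Any number above the infimum exceeds some admissible \<open>C\<close>, and
      nonnegativity of \<open>weak_norm\<close> lets \<open>C\<close> be enlarged to
      \<open>1 + e\<close>.\<close>
    have bound: "lp_norm p n (\<lambda>i. f (x i)) \<le> (1 + e) * ?W" if "e > 0" for e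
    proof -
      have "pnorm p f < ereal (1 + e)"
        by (rule order.strict_trans1[OF le]) (use that in \<open>simp add: one_ereal_def\<close>)
      then obtain C where "C < 1 + e" "lp_norm p n (\<lambda>i. f (x i)) \<le> C * ?W"
        unfolding pnorm_def Inf_less_iff by auto
      then show ?thesis
        using weak_norm_nonneg[OF assms, of n x]
        by (meson less_imp_le mult_right_mono order.trans)
    qed
    have "((\<lambda>e. (1 + e) * ?W) \<longlongrightarrow> (1 + 0) * ?W) (at_right 0)"
      by (intro tendsto_intros)
    then have "lp_norm p n (\<lambda>i. f (x i)) \<le> (1 + 0) * ?W"
      by (rule tendsto_lowerbound) (auto simp: eventually_at_right_less bound
          intro: eventually_mono[OF eventually_at_right_less])
    then show "lp_norm p n (\<lambda>i. f (x i)) \<le> ?W"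
      by simp
  qed
next
  assume ?R
  then show "pnorm p f \<le> 1"
    unfolding pnorm_def by (intro Inf_lower) (auto intro!: exI[of _ 1] simp: one_ereal_def)
qed

lemma pnorm_le_one_mono:
  assumes "1 \<le> p" "pnorm p f \<le> 1" "\<And>\<phi>. \<bar>g \<phi>\<bar> \<le> \<bar>f \<phi>\<bar>"
  shows "pnorm p g \<le> 1"
  unfolding pnorm_le_one_iff[OF assms(1)]
proof (intro allI)
  fix n x
  have "lp_norm p n (\<lambda>i. g (x i)) \<le> lp_norm p n (\<lambda>i. f (x i))"
    by (rule lp_norm_mono[OF assms(1) assms(3)])
  also have "\<dots> \<le> weak_norm p n x"
    using assms(2) by (simp add: pnorm_le_one_iff[OF assms(1)])
  finally show "lp_norm p n (\<lambda>i. g (x i)) \<le> weak_norm p n x" .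
qed

text \<open>One-term families already give this: the \<open>p\<close>-norm dominates the sup norm on
  the dual ball.\<close>

lemma abs_le_norm_if_pnorm_le_one:
  assumes "1 \<le> p" "pnorm p f \<le> 1"
  shows "\<bar>f \<phi>\<bar> \<le> norm \<phi>"
proof -
  have "lp_norm p (Suc 0) (\<lambda>_. f \<phi>) \<le> weak_norm p (Suc 0) (\<lambda>_. \<phi>)"
    using assms(2)[unfolded pnorm_le_one_iff[OF assms(1)]] by (rule spec2)
  then show ?thesis
    using weak_norm_one_le[OF assms(1), of "\<lambda>_. \<phi>"] by (simp add: lp_norm_one assms(1))
qed

lemma pnorm_zero: "pnorm p (\<lambda>_. 0) \<le> 0"
  unfolding pnorm_def by (rule Inf_lower) (auto intro!: exI[of _ 0] simp: zero_ereal_def)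

section \<open>The lattice \<open>H_w\<close> and the ideal \<open>I_w\<close>\<close>

lemma H_wI:
  assumes "\<And>t \<phi>. 0 \<le> t \<Longrightarrow> f (t *\<^sub>R \<phi>) = t * f \<phi>"
    and "\<And>S. bounded S \<Longrightarrow> continuous_map (subtopology weak_star_topology S) euclideanreal f"
  shows "f \<in> H_w"
  using assms by (simp add: H_w_def positively_homogeneous_def)

lemma H_w_scaleR: "f \<in> H_w \<Longrightarrow> 0 \<le> t \<Longrightarrow> f (t *\<^sub>R \<phi>) = t * f \<phi>"
  by (simp add: H_w_def positively_homogeneous_def)

lemma H_w_continuous:
  "f \<in> H_w \<Longrightarrow> bounded S \<Longrightarrow> continuous_map (subtopology weak_star_topology S) euclideanreal f"
  by (simp add: H_w_def)

lemma H_w_zero: "(\<lambda>_. 0) \<in> H_w"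
  by (rule H_wI) auto

lemma H_w_add: "f \<in> H_w \<Longrightarrow> g \<in> H_w \<Longrightarrow> (\<lambda>\<phi>. f \<phi> + g \<phi>) \<in> H_w"
  by (rule H_wI, simp add: H_w_scaleR distrib_left, rule continuous_map_add)
    (simp_all add: H_w_continuous)

lemma H_w_cmult: "f \<in> H_w \<Longrightarrow> (\<lambda>\<phi>. c * f \<phi>) \<in> H_w"
  by (rule H_wI, simp add: H_w_scaleR, rule continuous_map_real_mult)
    (simp_all add: H_w_continuous)

lemma H_w_abs: "f \<in> H_w \<Longrightarrow> (\<lambda>\<phi>. \<bar>f \<phi>\<bar>) \<in> H_w"
  by (rule H_wI, simp add: H_w_scaleR abs_mult, rule continuous_map_real_abs)
    (simp_all add: H_w_continuous)

lemma H_w_max: "f \<in> H_w \<Longrightarrow> g \<in> H_w \<Longrightarrow> (\<lambda>\<phi>. max (f \<phi>) (g \<phi>)) \<in> H_w"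
  by (rule H_wI, simp add: H_w_scaleR max_mult_distrib_left, rule continuous_map_real_max)
    (simp_all add: H_w_continuous)

lemma H_w_min: "f \<in> H_w \<Longrightarrow> g \<in> H_w \<Longrightarrow> (\<lambda>\<phi>. min (f \<phi>) (g \<phi>)) \<in> H_w"
  by (rule H_wI, simp add: H_w_scaleR min_mult_distrib_left, rule continuous_map_real_min)
    (simp_all add: H_w_continuous)

lemma H_w_point_eval: "point_eval x \<in> H_w"
  by (rule H_wI)
    (auto simp: point_eval_def scaleR_blinfun.rep_eq weak_star_topology_def
      intro!: continuous_map_from_subtopology strong_operator_topology_continuous_evaluation)

text \<open>Makes \<open>H_w\<close> itself one of the ideals intersected in \<open>I_w\<close>, so
  that \<open>I_w\<close> lies inside \<open>H_w\<close>.\<close>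

lemma order_ideal_H_w_H_w: "order_ideal_H_w H_w"
  by (simp add: order_ideal_H_w_def H_w_zero H_w_add H_w_cmult)

lemma order_ideal_H_w_solid:
  assumes "order_ideal_H_w J" "f \<in> H_w" "g \<in> J" "\<And>\<phi>. \<bar>f \<phi>\<bar> \<le> \<bar>g \<phi>\<bar>"
  shows "f \<in> J"
proof -
  have "\<forall>f\<in>H_w. \<forall>g\<in>J. (\<forall>\<phi>. \<bar>f \<phi>\<bar> \<le> \<bar>g \<phi>\<bar>) \<longrightarrow> f \<in> J"
    using assms(1) unfolding order_ideal_H_w_def by (elim conjE)
  from this[rule_format, OF assms(2-4)] show ?thesis .
qed

lemma I_wI:
  "(\<And>J. order_ideal_H_w J \<Longrightarrow> range point_eval \<subseteq> J \<Longrightarrow> f \<in> J) \<Longrightarrow> f \<in> I_w"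
  by (simp add: I_w_def)

lemma I_wD: "f \<in> I_w \<Longrightarrow> order_ideal_H_w J \<Longrightarrow> range point_eval \<subseteq> J \<Longrightarrow> f \<in> J"
  by (simp add: I_w_def)

lemma I_w_subset_H_w: "I_w \<subseteq> H_w"
proof
  show "f \<in> H_w" if "f \<in> I_w" for f
    by (rule I_wD[OF that order_ideal_H_w_H_w]) (simp add: image_subset_iff H_w_point_eval)
qed

lemma I_w_zero: "(\<lambda>_. 0) \<in> I_w"
  by (rule I_wI) (simp add: order_ideal_H_w_def)

lemma I_w_add:
  fixes f g :: "('a::banach \<Rightarrow>\<^sub>L real) \<Rightarrow> real"
  assumes "f \<in> I_w" "g \<in> I_w"
  shows "(\<lambda>\<phi>. f \<phi> + g \<phi>) \<in> I_w"
proof (rule I_wI)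
  fix J :: "(('a \<Rightarrow>\<^sub>L real) \<Rightarrow> real) set"
  assume J: "order_ideal_H_w J" "range point_eval \<subseteq> J"
  with assms have "f \<in> J" "g \<in> J"
    by (simp_all add: I_wD)
  with J(1) show "(\<lambda>\<phi>. f \<phi> + g \<phi>) \<in> J"
    by (simp add: order_ideal_H_w_def)
qed

lemma I_w_cmult:
  fixes f :: "('a::banach \<Rightarrow>\<^sub>L real) \<Rightarrow> real"
  assumes "f \<in> I_w"
  shows "(\<lambda>\<phi>. c * f \<phi>) \<in> I_w"
proof (rule I_wI)
  fix J :: "(('a \<Rightarrow>\<^sub>L real) \<Rightarrow> real) set"
  assume J: "order_ideal_H_w J" "range point_eval \<subseteq> J"
  with assms have "f \<in> J"
    by (simp add: I_wD)
  with J(1) show "(\<lambda>\<phi>. c * f \<phi>) \<in> J"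
    by (simp add: order_ideal_H_w_def)
qed

lemma I_w_solid:
  assumes "f \<in> H_w" "g \<in> I_w" "\<And>\<phi>. \<bar>f \<phi>\<bar> \<le> \<bar>g \<phi>\<bar>"
  shows "f \<in> I_w"
  by (rule I_wI, rule order_ideal_H_w_solid[OF _ assms(1) _ assms(3)])
    (auto intro: I_wD[OF assms(2)])

lemma point_eval_in_I_w: "point_eval x \<in> I_w"
  by (auto simp: I_w_def)

lemma I_w_sum_abs_point_eval:
  assumes "finite A"
  shows "(\<lambda>\<phi>. \<Sum>x\<in>A. \<bar>point_eval x \<phi>\<bar>) \<in> I_w"
  using assms
proof (induction A rule: finite_induct)
  case empty
  then show ?case
    by (simp add: I_w_zero)
next
  case (insert x A)
  \<comment> \<open>Solidity applies because a function and its absolute value have the same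
    modulus.\<close>
  have "(\<lambda>\<phi>. \<bar>point_eval x \<phi>\<bar>) \<in> I_w"
    by (rule I_w_solid[OF H_w_abs[OF H_w_point_eval] point_eval_in_I_w[of x]]) simp
  with insert show ?case
    by (simp add: I_w_add)
qed

section \<open>Truncation\<close>

text \<open>Homogeneity forces \<open>f 0 = 0\<close>, so continuity on the ball makes f small on a
  weak-star neighbourhood of 0, and such a neighbourhood contains one given by finitely many
  evaluations.\<close>

lemma H_w_small_near_zero:
  fixes f :: "('a::banach \<Rightarrow>\<^sub>L real) \<Rightarrow> real"
  assumes f: "f \<in> H_w" and "\<epsilon> > 0"
  obtains A \<delta> where "finite A" "\<delta> > 0"
    "\<And>\<phi>. norm \<phi> \<le> 1 \<Longrightarrow> (\<And>x. x \<in> A \<Longrightarrow> \<bar>blinfun_apply \<phi> x\<bar> < \<delta>) \<Longrightarrow> \<bar>f \<phi>\<bar> < \<epsilon>"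
proof -
  have f0: "f 0 = 0"
    using H_w_scaleR[OF f, of 0 0] by simp
  have "openin (subtopology weak_star_topology (cball 0 1))
      {\<phi> \<in> topspace (subtopology weak_star_topology (cball 0 1)). f \<phi> \<in> ball 0 \<epsilon>}"
    by (rule openin_continuous_map_preimage[OF H_w_continuous[OF f bounded_cball]]) auto
  \<comment> \<open>The weak-star topology is the pullback along \<open>blinfun_apply\<close> of the
    product topology on all functions, so \<open>U\<close> is open in that product.\<close>
  then obtain U where U: "open U" and
    eq: "{\<phi> \<in> cball 0 1. f \<phi> \<in> ball 0 \<epsilon>} = blinfun_apply -` U \<inter> cball 0 1"
    by (auto simp: weak_star_topology_def strong_operator_topology_topspace openin_subtopology
        strong_operator_topology_def openin_pullback_topology topspace_pullback_topology)
  have "0 \<in> {\<phi> \<in> cball 0 1. f \<phi> \<in> ball 0 \<epsilon>}"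
    using \<open>\<epsilon> > 0\<close> f0 by simp
  then have "blinfun_apply (0 :: 'a \<Rightarrow>\<^sub>L real) \<in> U"
    unfolding eq by blast
  with U obtain X where X: "blinfun_apply 0 \<in> (\<Pi>\<^sub>E i\<in>UNIV. X i)" "\<And>i. open (X i :: real set)"
    "finite {i. X i \<noteq> UNIV}" "(\<Pi>\<^sub>E i\<in>UNIV. X i) \<subseteq> U"
    using product_topology_open_contains_basis[of "\<lambda>_::'a. euclideanreal" UNIV U "blinfun_apply 0"]
    unfolding open_fun_def by auto
  \<comment> \<open>Only the coordinates in \<open>A\<close> are constrained by the basic open box
    \<open>X\<close>.\<close>
  define A where "A = {i. X i \<noteq> UNIV}"
  have "\<forall>i. \<exists>d>0. ball 0 d \<subseteq> X i"
    using X(1,2) by (auto simp: PiE_iff intro: openE)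
  then obtain d where d: "\<And>i. d i > 0" "\<And>i. ball 0 (d i) \<subseteq> X i"
    by metis
  \<comment> \<open>Inserting 1 keeps \<open>Min\<close> meaningful and positive when
    \<open>A\<close> is empty.\<close>
  define \<delta> where "\<delta> = Min (insert 1 (d ` A))"
  have "finite A"
    using X(3) by (simp add: A_def)
  then have "\<delta> > 0"
    using d(1) by (auto simp: \<delta>_def)
  moreover have "\<bar>f \<phi>\<bar> < \<epsilon>"
    if "norm \<phi> \<le> 1" and small: "\<And>x. x \<in> A \<Longrightarrow> \<bar>blinfun_apply \<phi> x\<bar> < \<delta>" for \<phi>
  proof -
    have "blinfun_apply \<phi> x \<in> X x" for x
    proof (cases "x \<in> A")
      case True
      then have "\<delta> \<le> d x"
        using \<open>finite A\<close> by (auto simp: \<delta>_def)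
      with small[OF True] d(2)[of x] show ?thesis
        by auto
    qed (simp add: A_def)
    then have "blinfun_apply \<phi> \<in> U"
      using X(4) by auto
    then have "\<phi> \<in> {\<phi> \<in> cball 0 1. f \<phi> \<in> ball 0 \<epsilon>}"
      unfolding eq using that(1) by simp
    then show ?thesis
      by simp
  qed
  ultimately show thesis
    using that[OF \<open>finite A\<close>] by blast
qed

lemma p_unit_ball_H_w_approx:
  fixes f :: "('a::banach \<Rightarrow>\<^sub>L real) \<Rightarrow> real"
  assumes "1 \<le> p" "f \<in> H_w" "pnorm p f \<le> 1" "\<epsilon> > 0"
  obtains g where "g \<in> I_w" "pnorm p g \<le> 1" "\<And>\<phi>. norm \<phi> \<le> 1 \<Longrightarrow> \<bar>f \<phi> - g \<phi>\<bar> < \<epsilon>"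
proof -
  obtain A \<delta> where A: "finite A" "\<delta> > 0"
    "\<And>\<phi>. norm \<phi> \<le> 1 \<Longrightarrow> (\<And>x. x \<in> A \<Longrightarrow> \<bar>blinfun_apply \<phi> x\<bar> < \<delta>) \<Longrightarrow> \<bar>f \<phi>\<bar> < \<epsilon>"
    using H_w_small_near_zero[OF assms(2,4)] by blast
  \<comment> \<open>The factor is chosen so that \<open>h \<phi> < 1\<close> forces every evaluation
    at a point of \<open>A\<close> below \<delta>.\<close>
  define h where "h \<phi> = (1/\<delta>) * (\<Sum>x\<in>A. \<bar>point_eval x \<phi>\<bar>)" for \<phi>
  define g where "g \<phi> = max (-1 * h \<phi>) (min (h \<phi>) (f \<phi>))" for \<phi>
  have hI: "h \<in> I_w"
    unfolding h_def by (intro I_w_cmult I_w_sum_abs_point_eval A)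
  then have hH: "h \<in> H_w"
    using I_w_subset_H_w by blast
  have h0: "0 \<le> h \<phi>" for \<phi>
    using A(2) by (auto simp: h_def intro!: sum_nonneg divide_nonneg_pos)
  have "g \<in> H_w"
    unfolding g_def by (intro H_w_max H_w_min H_w_cmult hH assms)
  moreover have "\<bar>g \<phi>\<bar> \<le> \<bar>h \<phi>\<bar>" for \<phi>
    using h0[of \<phi>] by (auto simp: g_def)
  ultimately have "g \<in> I_w"
    using hI I_w_solid by blast
  \<comment> \<open>As h is nonnegative, clamping to \<open>[-h, h]\<close> moves each value of f
    towards 0 without crossing it.\<close>
  moreover have "\<bar>g \<phi>\<bar> \<le> \<bar>f \<phi>\<bar>" for \<phi>
    using h0[of \<phi>] by (auto simp: g_def)
  then have "pnorm p g \<le> 1"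
    by (rule pnorm_le_one_mono[OF assms(1,3)])
  moreover have "\<bar>f \<phi> - g \<phi>\<bar> < \<epsilon>" if "norm \<phi> \<le> 1" for \<phi>
  proof (cases "\<bar>f \<phi>\<bar> \<le> h \<phi>")
    case True
    then have "g \<phi> = f \<phi>"
      by (auto simp: g_def)
    with assms(4) show ?thesis by simp
  next
    case False
    moreover have "\<bar>f \<phi>\<bar> \<le> 1"
      using abs_le_norm_if_pnorm_le_one[OF assms(1,3), of \<phi>] that by linarith
    ultimately have "h \<phi> < 1"
      by linarith
    then have sum: "(\<Sum>x\<in>A. \<bar>point_eval x \<phi>\<bar>) < \<delta>"
      using A(2) by (simp add: h_def)
    have "\<bar>blinfun_apply \<phi> x\<bar> < \<delta>" if "x \<in> A" for x
      using member_le_sum[of x A "\<lambda>x. \<bar>point_eval x \<phi>\<bar>"] that A(1) sum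
      by (simp add: point_eval_def)
    then have "\<bar>f \<phi>\<bar> < \<epsilon>"
      using A(3)[OF that] by blast
    moreover have "\<bar>f \<phi> - g \<phi>\<bar> \<le> \<bar>f \<phi>\<bar>"
      using h0[of \<phi>] by (auto simp: g_def)
    ultimately show ?thesis by linarith
  qed
  ultimately show thesis
    using that by blast
qed

section \<open>Closures in \<open>C(K)\<close>\<close>

lemma topspace_dual_ball_topology: "topspace dual_ball_topology = cball 0 1"
  by (simp add: dual_ball_topology_def weak_star_topology_def strong_operator_topology_topspace)

lemma restrict_in_mspace_CK:
  assumes "f \<in> H_w" "\<And>\<phi>. norm \<phi> \<le> 1 \<Longrightarrow> \<bar>f \<phi>\<bar> \<le> 1"
  shows "restrict f (cball 0 1) \<in> mspace CK"
proof -
  have "continuous_map dual_ball_topology euclideanreal (restrict f (cball 0 1))"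
    using H_w_continuous[OF assms(1) bounded_cball, of 0 1]
    unfolding dual_ball_topology_def[symmetric]
    by (rule continuous_map_eq) (simp add: topspace_dual_ball_topology)
  moreover have "Met_TC.mbounded (restrict f (cball 0 1) ` cball 0 1)"
    unfolding Met_TC.mbounded_def by (rule exI[of _ 0], rule exI[of _ 1]) (auto simp: assms(2))
  ultimately show ?thesis
    by (simp add: CK_def topspace_dual_ball_topology)
qed

text \<open>Closed balls are used because the distance in \<open>CK\<close> is a supremum: being at
  most \<epsilon> is equivalent to the pointwise bound, whereas strict inequality is not.\<close>

lemma in_sup_closure_iff:
  assumes "restrict_K A \<subseteq> mspace CK"
  shows "G \<in> sup_closure A \<longleftrightarrow> G \<in> mspace CK \<and>
    (\<forall>\<epsilon>>0. \<exists>f\<in>A. \<forall>\<phi>. norm \<phi> \<le> 1 \<longrightarrow> \<bar>G \<phi> - f \<phi>\<bar> \<le> \<epsilon>)"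
proof -
  interpret Metric_space "mspace CK" "mdist CK"
    by (rule Metric_space_mspace_mdist)
  have dist: "mdist CK G (restrict f (cball 0 1)) \<le> \<epsilon> \<longleftrightarrow> (\<forall>\<phi>. norm \<phi> \<le> 1 \<longrightarrow> \<bar>G \<phi> - f \<phi>\<bar> \<le> \<epsilon>)"
    if "f \<in> A" "G \<in> mspace CK" for f \<epsilon>
  proof -
    have "restrict f (cball 0 1) \<in> mspace CK"
      using assms that(1) by (auto simp: restrict_K_def)
    then show ?thesis
      using that(2) unfolding CK_def
      by (subst cfunspace_mdist_le) (auto simp: topspace_dual_ball_topology dist_real_def)
  qed
  have "sup_closure A = {G \<in> mspace CK. \<forall>\<epsilon>>0. \<exists>y\<in>restrict_K A. y \<in> mcball G \<epsilon>}"
    unfolding sup_closure_def mtopology_of_def metric_closure_of_alt ..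
  then have "G \<in> sup_closure A \<longleftrightarrow> G \<in> mspace CK \<and>
      (\<forall>\<epsilon>>0. \<exists>f\<in>A. mdist CK G (restrict f (cball 0 1)) \<le> \<epsilon>)"
    using assms by (auto simp: restrict_K_def image_subset_iff)
  then show ?thesis
    by (simp add: dist cong: conj_cong bex_cong)
qed

section \<open>Uniform limits of functions in \<open>H_w\<close>\<close>

text \<open>The values of G matter only on the dual ball. Homogeneity of the \<open>f k\<close>
  dictates the extension to the whole dual, and the error grows at most linearly in the norm, hence
  stays uniform on bounded sets.\<close>

lemma uniform_limit_H_w:
  fixes f :: "nat \<Rightarrow> ('a::banach \<Rightarrow>\<^sub>L real) \<Rightarrow> real"
  assumes f: "\<And>k. f k \<in> H_w"
    and close: "\<And>k \<phi>. norm \<phi> \<le> 1 \<Longrightarrow> \<bar>G \<phi> - f k \<phi>\<bar> \<le> inverse (real (Suc k))"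
  obtains F where "F \<in> H_w" "\<And>\<phi>. (\<lambda>k. f k \<phi>) \<longlonglongrightarrow> F \<phi>" "\<And>\<phi>. norm \<phi> \<le> 1 \<Longrightarrow> F \<phi> = G \<phi>"
proof -
  \<comment> \<open>Dividing by \<open>1 + norm \<phi>\<close> moves any functional into the ball
    and avoids division by 0 at the origin.\<close>
  define s where "s \<phi> = 1 + norm \<phi>" for \<phi> :: "'a \<Rightarrow>\<^sub>L real"
  have s: "s \<phi> > 0" for \<phi>
    by (simp add: s_def add_pos_nonneg)
  define F where "F \<phi> = s \<phi> * G (inverse (s \<phi>) *\<^sub>R \<phi>)" for \<phi>
  have bound: "\<bar>F \<phi> - f k \<phi>\<bar> \<le> s \<phi> * inverse (real (Suc k))" for \<phi> k
  proof -
    have "f k \<phi> = s \<phi> * f k (inverse (s \<phi>) *\<^sub>R \<phi>)"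
      using s[of \<phi>] H_w_scaleR[OF f, of "inverse (s \<phi>)" k \<phi>] by simp
    then have "\<bar>F \<phi> - f k \<phi>\<bar> = s \<phi> * \<bar>G (inverse (s \<phi>) *\<^sub>R \<phi>) - f k (inverse (s \<phi>) *\<^sub>R \<phi>)\<bar>"
      using s[of \<phi>] by (simp add: F_def abs_mult flip: right_diff_distrib)
    moreover have "norm (inverse (s \<phi>) *\<^sub>R \<phi>) \<le> 1"
      using s[of \<phi>] by (simp add: s_def field_simps)
    ultimately show ?thesis
      using close[of "inverse (s \<phi>) *\<^sub>R \<phi>" k] s[of \<phi>] by simp
  qed
  have lim: "(\<lambda>k. f k \<phi>) \<longlonglongrightarrow> F \<phi>" for \<phi>
  proof -
    have null: "(\<lambda>k. s \<phi> * inverse (real (Suc k))) \<longlonglongrightarrow> 0"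
      by (rule tendsto_mult_right_zero[OF LIMSEQ_inverse_real_of_nat])
    have le: "norm (f k \<phi> - F \<phi>) \<le> s \<phi> * inverse (real (Suc k))" for k
      unfolding real_norm_def using bound[of \<phi> k] by (subst abs_minus_commute)
    have "(\<lambda>k. f k \<phi> - F \<phi>) \<longlonglongrightarrow> 0"
      by (rule Lim_null_comparison[OF _ null], rule always_eventually, rule allI, rule le)
    then show ?thesis
      by (simp add: LIM_zero_iff)
  qed
  have "F \<in> H_w"
  proof (rule H_wI)
    \<comment> \<open>Since \<open>s\<close> is not homogeneous, the formula for \<open>F\<close>
      does not show homogeneity at once; it is inherited from the \<open>f k\<close> by uniqueness
      of limits.\<close>
    fix t :: real and \<phi> assume "0 \<le> t"
    then have "(\<lambda>k. f k (t *\<^sub>R \<phi>)) = (\<lambda>k. t * f k \<phi>)"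
      by (simp add: H_w_scaleR f)
    then have "(\<lambda>k. f k (t *\<^sub>R \<phi>)) \<longlonglongrightarrow> t * F \<phi>"
      using tendsto_mult_left[OF lim] by simp
    then show "F (t *\<^sub>R \<phi>) = t * F \<phi>"
      using LIMSEQ_unique lim by blast
  next
    fix S :: "('a \<Rightarrow>\<^sub>L real) set" assume S: "bounded S"
    then obtain R where R: "\<And>\<phi>. \<phi> \<in> S \<Longrightarrow> norm \<phi> \<le> R" "R > 0"
      using bounded_pos by metis
    have "continuous_map (subtopology weak_star_topology S) Met_TC.mtopology F"
    proof (rule Met_TC.continuous_map_uniform_limit)
      show "\<forall>\<^sub>F k in sequentially.
          continuous_map (subtopology weak_star_topology S) Met_TC.mtopology (f k)"
        using H_w_continuous[OF f S] by simp
      fix \<epsilon> :: real assume "\<epsilon> > 0"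
      have "\<forall>\<^sub>F k in sequentially. (1 + R) * inverse (real (Suc k)) < \<epsilon>"
        by (rule order_tendstoD(2)[OF tendsto_mult_right_zero[OF LIMSEQ_inverse_real_of_nat] \<open>\<epsilon> > 0\<close>])
      then show "\<forall>\<^sub>F k in sequentially. \<forall>\<phi>\<in>topspace (subtopology weak_star_topology S).
          F \<phi> \<in> UNIV \<and> dist (f k \<phi>) (F \<phi>) < \<epsilon>"
      proof (rule eventually_mono, intro ballI conjI UNIV_I)
        fix k \<phi> assume k: "(1 + R) * inverse (real (Suc k)) < \<epsilon>"
          and "\<phi> \<in> topspace (subtopology weak_star_topology S)"
        then have "s \<phi> * inverse (real (Suc k)) \<le> (1 + R) * inverse (real (Suc k))"
          by (intro mult_right_mono) (auto simp: s_def R)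
        then show "dist (f k \<phi>) (F \<phi>) < \<epsilon>"
          using k bound[of \<phi> k] unfolding dist_real_def by linarith
      qed
    qed auto
    then show "continuous_map (subtopology weak_star_topology S) euclideanreal F"
      by simp
  qed
  moreover have "F \<phi> = G \<phi>" if "norm \<phi> \<le> 1" for \<phi>
  proof -
    have le: "norm (f k \<phi> - G \<phi>) \<le> inverse (real (Suc k))" for k
      unfolding real_norm_def using close[OF that, of k] by (subst abs_minus_commute)
    have "(\<lambda>k. f k \<phi> - G \<phi>) \<longlonglongrightarrow> 0"
      by (rule Lim_null_comparison[OF _ LIMSEQ_inverse_real_of_nat], rule always_eventually,
          rule allI, rule le)
    then have "(\<lambda>k. f k \<phi>) \<longlonglongrightarrow> G \<phi>"
      by (simp add: LIM_zero_iff)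
    then show ?thesis
      using LIMSEQ_unique lim by blast
  qed
  ultimately show thesis
    using that lim by blast
qed

section \<open>Closedness of the unit ball of \<open>Hp_w p\<close> and equality of the
  closures\<close>

lemma p_unit_ball_Hp_w:
  "p_unit_ball p (Hp_w p) = {f :: ('a::banach \<Rightarrow>\<^sub>L real) \<Rightarrow> real. f \<in> H_w \<and> pnorm p f \<le> 1}"
proof -
  have "pnorm p f < \<infinity>" if "pnorm p f \<le> 1" for f :: "('a \<Rightarrow>\<^sub>L real) \<Rightarrow> real"
    by (rule le_less_trans[OF that]) simp
  then show ?thesis
    by (auto simp: p_unit_ball_def Hp_w_def)
qed

lemma restrict_K_p_unit_ball_Hp_w:
  assumes "1 \<le> p"
  shows "restrict_K (p_unit_ball p (Hp_w p)) \<subseteq> mspace CK"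
  unfolding restrict_K_def p_unit_ball_Hp_w
proof clarify
  fix f :: "('a::banach \<Rightarrow>\<^sub>L real) \<Rightarrow> real" assume "f \<in> H_w" "pnorm p f \<le> 1"
  then show "restrict f (cball 0 1) \<in> mspace CK"
    using restrict_in_mspace_CK abs_le_norm_if_pnorm_le_one[OF assms] order_trans by blast
qed

lemma sup_closure_p_unit_ball_Hp_w:
  assumes "1 \<le> p"
  shows "sup_closure (p_unit_ball p (Hp_w p :: (('a::banach \<Rightarrow>\<^sub>L real) \<Rightarrow> real) set)) \<subseteq>
    restrict_K (p_unit_ball p (Hp_w p))"
proof
  fix G :: "('a \<Rightarrow>\<^sub>L real) \<Rightarrow> real"
  assume "G \<in> sup_closure (p_unit_ball p (Hp_w p))"
  then have G: "G \<in> mspace CK" and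
    "\<forall>\<epsilon>>0. \<exists>f\<in>p_unit_ball p (Hp_w p). \<forall>\<phi>. norm \<phi> \<le> 1 \<longrightarrow> \<bar>G \<phi> - f \<phi>\<bar> \<le> \<epsilon>"
    by (auto simp: in_sup_closure_iff[OF restrict_K_p_unit_ball_Hp_w[OF assms]])
  then have "\<forall>k. \<exists>f\<in>p_unit_ball p (Hp_w p). \<forall>\<phi>. norm \<phi> \<le> 1 \<longrightarrow> \<bar>G \<phi> - f \<phi>\<bar> \<le> inverse (real (Suc k))"
    by simp
  then obtain f where f: "\<And>k. f k \<in> H_w" "\<And>k. pnorm p (f k) \<le> 1"
    "\<And>k \<phi>. norm \<phi> \<le> 1 \<Longrightarrow> \<bar>G \<phi> - f k \<phi>\<bar> \<le> inverse (real (Suc k))"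
    unfolding p_unit_ball_Hp_w by (metis (mono_tags, lifting) mem_Collect_eq)
  obtain F where F: "F \<in> H_w" "\<And>\<phi>. (\<lambda>k. f k \<phi>) \<longlonglongrightarrow> F \<phi>" "\<And>\<phi>. norm \<phi> \<le> 1 \<Longrightarrow> F \<phi> = G \<phi>"
    using uniform_limit_H_w[OF f(1,3)] by blast
  \<comment> \<open>The points \<open>x i\<close> may lie outside the dual ball, so convergence of
    \<open>f k\<close> to \<open>F\<close> on the whole dual is used here.\<close>
  have "pnorm p F \<le> 1"
    unfolding pnorm_le_one_iff[OF assms]
  proof (intro allI)
    fix n and x :: "nat \<Rightarrow> ('a \<Rightarrow>\<^sub>L real)"
    have "(\<lambda>k. lp_norm p n (\<lambda>i. f k (x i))) \<longlonglongrightarrow> lp_norm p n (\<lambda>i. F (x i))"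
      by (intro tendsto_lp_norm assms F)
    then show "lp_norm p n (\<lambda>i. F (x i)) \<le> weak_norm p n x"
      by (rule tendsto_upperbound) (use f(2) in \<open>auto simp: pnorm_le_one_iff[OF assms]\<close>)
  qed
  \<comment> \<open>Members of \<open>mspace CK\<close> are \<open>undefined\<close> off the ball,
    so agreement on the ball gives equality.\<close>
  moreover have "G = restrict F (cball 0 1)"
    using G F(3) by (auto simp: CK_def topspace_dual_ball_topology extensional_def restrict_def)
  ultimately show "G \<in> restrict_K (p_unit_ball p (Hp_w p))"
    using F(1) by (auto simp: restrict_K_def p_unit_ball_Hp_w)
qed

theorem proposition9p1:
  fixes p :: ereal
  assumes "1 \<le> p"
  shows "sup_closure (p_unit_ball p (I_w :: (('a::banach \<Rightarrow>\<^sub>L real) \<Rightarrow> real) set))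
           = sup_closure (p_unit_ball p (Ip_closure_w p))
       \<and> sup_closure (p_unit_ball p (Ip_closure_w p))
           = restrict_K (p_unit_ball p (Hp_w p :: (('a \<Rightarrow>\<^sub>L real) \<Rightarrow> real) set))"
proof -
  let ?BI = "p_unit_ball p (I_w :: (('a \<Rightarrow>\<^sub>L real) \<Rightarrow> real) set)"
  let ?BC = "p_unit_ball p (Ip_closure_w p :: (('a \<Rightarrow>\<^sub>L real) \<Rightarrow> real) set)"
  let ?BH = "p_unit_ball p (Hp_w p :: (('a \<Rightarrow>\<^sub>L real) \<Rightarrow> real) set)"
  have mono: "sup_closure A \<subseteq> sup_closure B"
    if "A \<subseteq> B" for A B :: "(('a \<Rightarrow>\<^sub>L real) \<Rightarrow> real) set"
    unfolding sup_closure_def restrict_K_def using that by (intro closure_of_mono image_mono)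
  have IH: "?BI \<subseteq> ?BH"
    using I_w_subset_H_w unfolding p_unit_ball_Hp_w unfolding p_unit_ball_def by blast
  have IC: "?BI \<subseteq> ?BC"
  proof
    fix f :: "('a \<Rightarrow>\<^sub>L real) \<Rightarrow> real" assume f: "f \<in> ?BI"
    \<comment> \<open>Each f approximates itself; the difference is the zero function.\<close>
    have "pnorm p (\<lambda>\<phi>. f \<phi> - f \<phi>) < ereal \<epsilon>" if "\<epsilon> > 0" for \<epsilon>
      using pnorm_zero[of p] that by (auto intro: le_less_trans)
    moreover have "f \<in> I_w" "pnorm p f \<le> 1" "f \<in> Hp_w p"
      using f IH by (auto simp: p_unit_ball_def)
    ultimately show "f \<in> ?BC"
      unfolding p_unit_ball_def Ip_closure_w_def by blast
  qed
  have CH: "?BC \<subseteq> ?BH"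
    by (auto simp: p_unit_ball_def Ip_closure_w_def)
  note K = restrict_K_p_unit_ball_Hp_w[OF assms, where 'a = 'a]
  have dense: "restrict_K ?BH \<subseteq> sup_closure ?BI"
  proof
    fix G :: "('a \<Rightarrow>\<^sub>L real) \<Rightarrow> real" assume G: "G \<in> restrict_K ?BH"
    then obtain f where f: "f \<in> H_w" "pnorm p f \<le> 1" and Gf: "G = restrict f (cball 0 1)"
      by (auto simp: restrict_K_def p_unit_ball_Hp_w)
    have "restrict_K ?BI \<subseteq> mspace CK"
      using K IH by (auto simp: restrict_K_def)
    moreover have "\<exists>g\<in>?BI. \<forall>\<phi>. norm \<phi> \<le> 1 \<longrightarrow> \<bar>G \<phi> - g \<phi>\<bar> \<le> \<epsilon>" if "\<epsilon> > 0" for \<epsilon>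
    proof -
      obtain g where "g \<in> I_w" "pnorm p g \<le> 1" "\<And>\<phi>. norm \<phi> \<le> 1 \<Longrightarrow> \<bar>f \<phi> - g \<phi>\<bar> < \<epsilon>"
        using p_unit_ball_H_w_approx[OF assms f \<open>\<epsilon> > 0\<close>] by blast
      then show ?thesis
        by (auto simp: p_unit_ball_def Gf intro!: bexI[of _ g] less_imp_le)
    qed
    ultimately show "G \<in> sup_closure ?BI"
      using G K by (auto simp: in_sup_closure_iff)
  qed
  \<comment> \<open>The inclusions close up in a cycle: closure of \<open>?BI\<close>, closure of
    \<open>?BC\<close>, closure of \<open>?BH\<close>, restrictions of \<open>?BH\<close>, and back
    to the closure of \<open>?BI\<close>.\<close>
  show ?thesis
    using mono[OF IC] mono[OF CH] dense sup_closure_p_unit_ball_Hp_w[OF assms, where 'a = 'a]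
    by blast
qed

end
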